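(* Let $q_c\approx 2.32472$ be the real root of $x^3-3x^2+2x-1=0$. Then \[ \mathcal{B}_{2^{\aleph_0}}=(1,\infty),\qquad \mathcal{B}_{\aleph_0}=[2,\infty),\qquad \mathcal{B}_k=(q_c,\infty)\ \text{ for every integer } k\ge 2 . \]
   Context: For a real number $q>1$, a $q$-expansion of a real number $x$ is an infinite sequence $(d_i)_{i\ge1}$ with $d_i\in\{0,1,q\}$ for all $i\ge 1$ and $x=\sum_{i=1}^\infty d_i/q^i$ (the digit set $\{0,1,q\}$ depends on the base $q$). Let $E_q$ be the set of real numbers having at least one $q$-expansion. For $k\in\{1,2,3,\dots\}\cup\{\aleph_0,2^{\aleph_0}\}$ let \[ \mathcal{B}_k:=\{q\in(1,\infty): \text{there exists } x\in E_q \text{ with precisely } k \text{ different } q\text{-expansions}\}, \] where "precisely $k$" means that the set of all $q$-expansions of $x$ has cardinality $k$. *)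

theory Defs
  imports Complex_Main "HOL-Library.Equipollence"
begin

text \<open>
  Digit sequences are indexed from \<open>0\<close>, so \<open>d i\<close> is the digit usually written
  \<open>d\<^sub>i\<^sub>+\<^sub>1\<close> and has weight \<open>1 / q ^ (i + 1)\<close>.
\<close>

definition q_expansions :: "real \<Rightarrow> real \<Rightarrow> (nat \<Rightarrow> real) set" where
  "q_expansions q x =
     {d. (\<forall>i. d i \<in> {0, 1, q}) \<and> (\<lambda>i. d i / q ^ Suc i) sums x}"

definition expandable :: "real \<Rightarrow> real set" where
  "expandable q = {x. q_expansions q x \<noteq> {}}"

text \<open>
  The cardinal \<open>k\<close> is given by a representative set \<open>K\<close>: for a finite \<open>k\<close> take
  \<open>{..<k}\<close>, for \<open>\<aleph>\<^sub>0\<close> take \<open>UNIV :: nat set\<close>, and for the cardinality of the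
  continuum take \<open>Pow (UNIV :: nat set)\<close>.
\<close>

definition bases_with_card :: "'k set \<Rightarrow> real set" where
  "bases_with_card K =
     {q. 1 < q \<and> (\<exists>x \<in> expandable q. q_expansions q x \<approx> K)}"

definition q_c :: real where
  "q_c = (THE x. x ^ 3 - 3 * x ^ 2 + 2 * x - 1 = 0)"

lemma q_c_ex1: "\<exists>!x::real. x ^ 3 - 3 * x ^ 2 + 2 * x - 1 = 0"
proof -
  define f :: "real \<Rightarrow> real" where "f = (\<lambda>x. x ^ 3 - 3 * x ^ 2 + 2 * x - 1)"
  have "\<exists>x\<ge>2. x \<le> 3 \<and> f x = 0"
    by (rule IVT') (auto simp: f_def intro!: continuous_intros)
  then obtain x where x: "f x = 0" by blast
  have gt: "y > 2" if "f y = 0" for y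
  proof (rule ccontr)
    assume "\<not> y > 2"
    have eq: "y * (y - 1) * (y - 2) = 1"
      using that by (simp add: f_def algebra_simps power2_eq_square power3_eq_cube)
    show False
    proof (cases "y * (y - 1) \<ge> 0")
      case True
      then have "y * (y - 1) * (y - 2) \<le> 0"
        using \<open>\<not> y > 2\<close> by (intro mult_nonneg_nonpos) auto
      with eq show False by simp
    next
      case False
      then have "0 < y" "y < 1" by (auto simp: zero_le_mult_iff not_le)
      have "y * (1 - y) \<le> 1 / 4"
        using zero_le_power2[of "y - 1 / 2"]
        by (simp add: algebra_simps power2_eq_square)
      then have "y * (1 - y) * (2 - y) \<le> 1 / 4 * 2"
        using \<open>0 < y\<close> \<open>y < 1\<close> by (intro mult_mono) auto
      with eq show False by (simp add: algebra_simps)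
    qed
  qed
  have "y = x" if y: "f y = 0" for y
  proof -
    have "(y - x) *
        ((x - 2) * (x - 2) + (y - 2) * (y - 2) + (x - 2) * (y - 2) + 3 * (x - 2) + 3 * (y - 2) + 2) = f y - f x"
      by (simp add: f_def algebra_simps power2_eq_square power3_eq_cube)
    moreover have
      "(x - 2) * (x - 2) + (y - 2) * (y - 2) + (x - 2) * (y - 2) + 3 * (x - 2) + 3 * (y - 2) + 2 > 0"
      using gt[OF x] gt[OF y] by (intro add_pos_pos mult_pos_pos) auto
    ultimately show ?thesis using x y by simp
  qed
  with x show ?thesis unfolding f_def by blast
qed

lemma q_c_root: "q_c ^ 3 - 3 * q_c ^ 2 + 2 * q_c - 1 = 0"
  unfolding q_c_def by (rule theI'[OF q_c_ex1])

lemma q_c_approx: "2.324715 < q_c" "q_c < 2.324725"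
proof -
  define f :: "real \<Rightarrow> real" where "f = (\<lambda>x. x ^ 3 - 3 * x ^ 2 + 2 * x - 1)"
  have "\<exists>x\<ge>2.324715. x \<le> 2.324725 \<and> f x = 0"
    by (rule IVT') (auto simp: f_def power2_eq_square power3_eq_cube intro!: continuous_intros)
  then obtain x where x: "2.324715 \<le> x" "x \<le> 2.324725" "f x = 0" by blast
  have "x = q_c" using q_c_ex1 q_c_root x(3) unfolding f_def by blast
  moreover have "f 2.324715 \<noteq> 0" "f 2.324725 \<noteq> 0"
    by (simp_all add: f_def power2_eq_square power3_eq_cube)
  ultimately show "2.324715 < q_c" "q_c < 2.324725"
    using x by (metis order_le_less)+
qed

end

(* A sequence of digits is an expansion of x iff the orbit x, q x - d_0, q (q x - d_0) - d_1, ...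
   stays in [0, q / (q - 1)], so counting expansions means counting the paths of a branching
   dynamical system. The word 10 has the same value as 0q.
   - (10)^oo therefore has a continuum of expansions, and 0 q^oo = 1^n 0 q^oo has countably many
     for q >= 2. For k >= 1, 0 q^(k-1) t has exactly k expansions as soon as t lies between
     1 / (q - 1) and 1 and has a unique expansion; such t of the form (1^n q)^oo exist when
     q (q - 1) (q - 2) > 1, that is, when q > q_c.
   - For q <= q_c every orbit of an interior point meets a point with two admissible digits.
     If a point had finitely many but at least two expansions, its orbits would contain a last
     branching point, all of whose successors are endpoints of the interval, which is impossible.
   - For q < 2 both branches can be taken inside the open interval, so that a diagonal argument
     excludes countability. *)

theory Submission
  imports Defs "HOL-Library.Countable_Set"
begin

subsection \<open>Expansions and their remainders\<close>

text \<open>The number that the digits from position n on still have to represent: q^n times the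
  difference of x and the n-th partial sum. It is the orbit of x under the maps y -> q y - a, one
  for each digit a.\<close>

primrec remainder :: "real \<Rightarrow> (nat \<Rightarrow> real) \<Rightarrow> real \<Rightarrow> nat \<Rightarrow> real" where
  "remainder q d x 0 = x"
| "remainder q d x (Suc n) = q * remainder q d x n - d n"

lemma remainder_cong:
  assumes "\<And>i. i < n \<Longrightarrow> d i = e i"
  shows "remainder q d x n = remainder q e x n"
  using assms by (induction n) auto

lemma remainder_add:
  "remainder q d x (m + n) = remainder q (\<lambda>i. d (m + i)) (remainder q d x m) n"
  by (induction n) auto

text \<open>Repeated multiplication by q > 1 passes c, and the first passage overshoots by a factor
  of at most q. Later z is the distance of an orbit from the fixed point of the digit it is forced
  to repeat.\<close>

lemma scaling_escape:
  fixes q c z :: real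
  assumes "1 < q" "0 < z" "z \<le> c" "P z"
    and step: "\<And>y. P y \<Longrightarrow> 0 < y \<Longrightarrow> y \<le> c \<Longrightarrow> P (q * y)"
  shows "\<exists>y. P y \<and> c < y \<and> y \<le> q * c"
proof -
  define n where "n = (LEAST n. c < q ^ n * z)"
  obtain k where "c / z < q ^ k" using real_arch_pow[OF assms(1)] by blast
  then have "c < q ^ k * z" using assms(2) by (simp add: field_simps)
  then have n: "c < q ^ n * z" unfolding n_def by (rule LeastI)
  have less: "q ^ i * z \<le> c" if "i < n" for i
    using not_less_Least[of i "\<lambda>n. c < q ^ n * z"] that by (simp add: n_def)
  have "i \<le> n \<Longrightarrow> P (q ^ i * z)" for i
  proof (induction i)
    case (Suc i)
    then show ?case using step[of "q ^ i * z"] less[of i] assms(1,2) by (simp add: mult.assoc)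
  qed (use assms(4) in simp)
  moreover obtain m where "n = Suc m" using n assms(3) by (cases n) auto
  moreover from this have "q ^ n * z \<le> q * c"
    using less[of m] assms(1) by (simp add: mult.assoc)
  ultimately show ?thesis using n by blast
qed

text \<open>The product form of the cubic is monotone above 2, which makes bases comparable with
  \<open>q_c\<close>.\<close>

lemma q_c_root_product: "q_c * (q_c - 1) * (q_c - 2) = 1"
  using q_c_root by (simp add: power2_eq_square power3_eq_cube algebra_simps)

lemma product_gt_1:
  assumes "q_c < q"
  shows "2 < q" "1 < q * (q - 1) * (q - 2)"
proof -
  show "2 < q" using assms q_c_approx by simp
  have "q_c * (q_c - 1) * (q_c - 2) < q * (q - 1) * (q - 2)"
    using assms q_c_approx by (intro mult_strict_mono) auto
  then show "1 < q * (q - 1) * (q - 2)" by (simp add: q_c_root_product)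
qed

lemma product_le_1:
  assumes "1 < q" "q \<le> q_c"
  shows "q * (q - 1) * (q - 2) \<le> 1"
proof (cases "2 \<le> q")
  case True
  have "q * (q - 1) * (q - 2) \<le> q_c * (q_c - 1) * (q_c - 2)"
    using assms q_c_approx True by (intro mult_mono) auto
  then show ?thesis by (simp add: q_c_root_product)
next
  case False
  then have "q * (q - 1) * (q - 2) \<le> 0" using assms by (intro mult_nonneg_nonpos) auto
  then show ?thesis by simp
qed

context
  fixes q :: real
  assumes q: "1 < q"
begin

lemma sum_remainder:
  "(\<Sum>i<n. d i / q ^ Suc i) = x - remainder q d x n / q ^ n"
proof (induction n)
  case (Suc n)
  have "remainder q d x (Suc n) / q ^ Suc n = remainder q d x n / q ^ n - d n / q ^ Suc n"
    using q by (simp add: field_simps)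
  with Suc show ?case by simp
qed simp

lemma sums_shift_iff:
  "(\<lambda>i. d i / q ^ Suc i) sums x \<longleftrightarrow> (\<lambda>i. d (Suc i) / q ^ Suc i) sums (q * x - d 0)"
proof -
  have "(\<lambda>i. d i / q ^ Suc i) sums x \<longleftrightarrow> (\<lambda>i. d (Suc i) / q ^ Suc (Suc i)) sums (x - d 0 / q)"
    by (subst sums_Suc_iff) simp
  also have "\<dots> \<longleftrightarrow> (\<lambda>i. q * (d (Suc i) / q ^ Suc (Suc i))) sums (q * (x - d 0 / q))"
    using q by (subst sums_mult_iff) auto
  also have "(\<lambda>i. q * (d (Suc i) / q ^ Suc (Suc i))) = (\<lambda>i. d (Suc i) / q ^ Suc i)"
    using q by auto
  also have "q * (x - d 0 / q) = q * x - d 0"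
    using q by (simp add: field_simps)
  finally show ?thesis .
qed

lemma expansion_Suc_iff:
  "d \<in> q_expansions q x \<longleftrightarrow> d 0 \<in> {0, 1, q} \<and> (\<lambda>i. d (Suc i)) \<in> q_expansions q (q * x - d 0)"
proof -
  have "(\<forall>i. d i \<in> {0, 1, q}) \<longleftrightarrow> d 0 \<in> {0, 1, q} \<and> (\<forall>i. d (Suc i) \<in> {0, 1, q})"
    by (metis not0_implies_Suc)
  then show ?thesis
    unfolding q_expansions_def mem_Collect_eq sums_shift_iff[of d] by blast
qed

lemma expansion_bounds:
  assumes "d \<in> q_expansions q x"
  shows "0 \<le> x" "x \<le> q / (q - 1)"
proof -
  have d: "d i \<in> {0, 1, q}" for i
    using assms by (auto simp: q_expansions_def)
  have s: "(\<lambda>i. d i / q ^ Suc i) sums x"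
    using assms by (simp add: q_expansions_def)
  have di: "0 \<le> d i \<and> d i \<le> q" for i using d[of i] q by auto
  show "0 \<le> x"
    using sums_le[OF _ sums_zero s] di q by simp
  have "(\<lambda>i. (1 / q) ^ i) sums (1 / (1 - 1 / q))"
    using q by (intro geometric_sums) simp
  moreover have "(\<lambda>i. (1 / q) ^ i) = (\<lambda>i. q / q ^ Suc i)"
    using q by (auto simp: power_one_over)
  moreover have "1 / (1 - 1 / q) = q / (q - 1)"
    using q by (simp add: field_simps)
  ultimately have top: "(\<lambda>i. q / q ^ Suc i) sums (q / (q - 1))" by simp
  have "d i / q ^ Suc i \<le> q / q ^ Suc i" for i
    using di q by (intro divide_right_mono) auto
  then show "x \<le> q / (q - 1)" using s top by (rule sums_le)
qed

lemma expansion_tail: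
  "d \<in> q_expansions q x \<Longrightarrow> (\<lambda>i. d (n + i)) \<in> q_expansions q (remainder q d x n)"
proof (induction n)
  case (Suc n)
  then show ?case using expansion_Suc_iff[of "\<lambda>i. d (n + i)"] by simp
qed simp

text \<open>The n-th partial sum misses x by exactly the remainder divided by q^n, which tends to 0
  for bounded remainders; conversely each remainder is expanded by a tail. Convergence thus becomes
  confinement of an orbit.\<close>

lemma expansion_iff_remainder:
  "d \<in> q_expansions q x \<longleftrightarrow>
    (\<forall>i. d i \<in> {0, 1, q}) \<and> (\<forall>n. remainder q d x n \<in> {0..q / (q - 1)})"
proof (intro iffI conjI)
  assume "d \<in> q_expansions q x"
  then show "\<forall>i. d i \<in> {0, 1, q}" "\<forall>n. remainder q d x n \<in> {0..q / (q - 1)}"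
    using expansion_bounds[OF expansion_tail] by (auto simp: q_expansions_def)
next
  assume *: "(\<forall>i. d i \<in> {0, 1, q}) \<and> (\<forall>n. remainder q d x n \<in> {0..q / (q - 1)})"
  have "(\<lambda>n. (q / (q - 1)) * (1 / q) ^ n) \<longlonglongrightarrow> (q / (q - 1)) * 0"
    using q by (intro tendsto_mult_left LIMSEQ_power_zero) auto
  then have "(\<lambda>n. (q / (q - 1)) * (1 / q) ^ n) \<longlonglongrightarrow> 0" by simp
  moreover have "0 \<le> remainder q d x n / q ^ n"
      "remainder q d x n / q ^ n \<le> (q / (q - 1)) * (1 / q) ^ n" for n
  proof -
    show "0 \<le> remainder q d x n / q ^ n" using * q by simp
    have "remainder q d x n / q ^ n \<le> (q / (q - 1)) / q ^ n"
      using * q by (intro divide_right_mono) auto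
    then show "remainder q d x n / q ^ n \<le> (q / (q - 1)) * (1 / q) ^ n"
      by (simp add: power_one_over)
  qed
  ultimately have "(\<lambda>n. remainder q d x n / q ^ n) \<longlonglongrightarrow> 0"
    using tendsto_sandwich[of "\<lambda>_. 0" "\<lambda>n. remainder q d x n / q ^ n" sequentially
      "\<lambda>n. (q / (q - 1)) * (1 / q) ^ n" 0] by simp
  then have "(\<lambda>n. x - remainder q d x n / q ^ n) \<longlonglongrightarrow> x - 0"
    by (intro tendsto_intros)
  then have "(\<lambda>n. \<Sum>i<n. d i / q ^ Suc i) \<longlonglongrightarrow> x"
    by (simp only: sum_remainder[of d _ x] diff_zero)
  then show "d \<in> q_expansions q x"
    using * by (simp add: q_expansions_def sums_def del: power_Suc)
qed

section \<open>Splitting by the first digit\<close>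

lemma expansions_decompose:
  "q_expansions q x = (\<Union>a\<in>{0, 1, q}. case_nat a ` q_expansions q (q * x - a))"
proof (intro set_eqI iffI)
  fix d assume "d \<in> q_expansions q x"
  moreover have "d = case_nat (d 0) (\<lambda>i. d (Suc i))"
    by (auto simp: fun_eq_iff split: nat.split)
  ultimately show "d \<in> (\<Union>a\<in>{0, 1, q}. case_nat a ` q_expansions q (q * x - a))"
    using expansion_Suc_iff[of d x] by blast
next
  fix d assume "d \<in> (\<Union>a\<in>{0, 1, q}. case_nat a ` q_expansions q (q * x - a))"
  then show "d \<in> q_expansions q x"
    using expansion_Suc_iff[of d x] by auto
qed

lemma inj_case_nat: "inj (case_nat (a :: 'a) :: (nat \<Rightarrow> 'a) \<Rightarrow> _)"
proof (rule injI)
  fix f g assume "case_nat a f = case_nat a g"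
  then have "case_nat a f (Suc i) = case_nat a g (Suc i)" for i by simp
  then show "f = g" by auto
qed

lemma finite_expansions_child:
  assumes "finite (q_expansions q x)" "a \<in> {0, 1, q}"
  shows "finite (q_expansions q (q * x - a))"
proof -
  have "finite (case_nat a ` q_expansions q (q * x - a))"
    using assms expansions_decompose[of x] by (auto intro: finite_subset)
  then show ?thesis
    by (rule finite_imageD) (rule inj_on_subset[OF inj_case_nat], simp)
qed

lemma card_expansions:
  assumes "\<And>a. a \<in> {0, 1, q} \<Longrightarrow> finite (q_expansions q (q * x - a))"
  shows "finite (q_expansions q x)"
    and "card (q_expansions q x) = card (q_expansions q (q * x))
      + card (q_expansions q (q * x - 1)) + card (q_expansions q (q * x - q))"
proof -
  show "finite (q_expansions q x)"
    unfolding expansions_decompose[of x] using assms by (intro finite_UN_I finite_imageI) auto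
  have "card (q_expansions q x) = (\<Sum>a\<in>{0, 1, q}. card (case_nat a ` q_expansions q (q * x - a)))"
    unfolding expansions_decompose[of x]
  proof (rule card_UN_disjoint)
    show "\<forall>a\<in>{0, 1, q}. \<forall>b\<in>{0, 1, q}. a \<noteq> b \<longrightarrow>
        case_nat a ` q_expansions q (q * x - a) \<inter> case_nat b ` q_expansions q (q * x - b) = {}"
      by (auto dest!: fun_cong[where x = 0])
  qed (use assms in auto)
  then show "card (q_expansions q x) = card (q_expansions q (q * x))
      + card (q_expansions q (q * x - 1)) + card (q_expansions q (q * x - q))"
    using q by (simp add: card_image inj_on_subset[OF inj_case_nat])
qed

lemma no_expansions:
  "x \<notin> {0..q / (q - 1)} \<Longrightarrow> q_expansions q x = {}"
  using expansion_bounds by auto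

text \<open>Choosing at every point of \<open>V\<close> a digit that stays in \<open>V\<close>
  produces an orbit confined to the interval; the chosen digits are the expansion.\<close>

lemma expansion_exists:
  assumes "V \<subseteq> {0..q / (q - 1)}" "\<And>x. x \<in> V \<Longrightarrow> \<exists>a\<in>{0, 1, q}. q * x - a \<in> V" "x \<in> V"
  shows "q_expansions q x \<noteq> {}"
proof -
  obtain g where g: "\<And>x. x \<in> V \<Longrightarrow> g x \<in> {0, 1, q} \<and> q * x - g x \<in> V"
    using assms(2) by metis
  define r where "r n = ((\<lambda>x. q * x - g x) ^^ n) x" for n
  have r: "r n \<in> V" for n
    by (induction n) (use g assms(3) in \<open>auto simp: r_def\<close>)
  have "remainder q (\<lambda>n. g (r n)) x n = r n" for n
    by (induction n) (auto simp: r_def)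
  moreover have "r n \<in> {0..q / (q - 1)}" "g (r n) \<in> {0, 1, q}" for n
    using r[of n] g[of "r n"] assms(1) by blast+
  ultimately have "(\<lambda>n. g (r n)) \<in> q_expansions q x"
    unfolding expansion_iff_remainder by simp
  then show ?thesis by blast
qed

text \<open>Every orbit starting in \<open>V\<close> is trapped there, since at each of its points
  all digits but one leave the interval; two expansions therefore agree digit by digit.\<close>

lemma expansion_unique:
  assumes V: "V \<subseteq> {0..q / (q - 1)}" "x \<in> V"
    and step: "\<And>x. x \<in> V \<Longrightarrow> \<exists>a\<in>{0, 1, q}. q * x - a \<in> V \<and>
                 (\<forall>b\<in>{0, 1, q} - {a}. q * x - b \<notin> {0..q / (q - 1)})"
  shows "is_singleton (q_expansions q x)"
proof -
  have "d = e" if de: "d \<in> q_expansions q x" "e \<in> q_expansions q x" for d e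
  proof
    have "remainder q d x n \<in> V \<and> remainder q e x n = remainder q d x n \<and> d n = e n" for n
    proof (induction n rule: less_induct)
      case (less n)
      have r: "remainder q e x n = remainder q d x n" "remainder q d x n \<in> V"
      proof -
        show "remainder q e x n = remainder q d x n"
          using less by (intro remainder_cong) auto
        show "remainder q d x n \<in> V"
        proof (cases n)
          case (Suc m)
          then have m: "remainder q d x m \<in> V" using less by auto
          have "d m \<in> {0, 1, q}" "remainder q d x (Suc m) \<in> {0..q / (q - 1)}"
            using de(1) unfolding expansion_iff_remainder by blast+
          then show ?thesis using step[OF m] Suc by auto
        qed (use V in auto)
      qed
      have "d n \<in> {0, 1, q}" "remainder q d x (Suc n) \<in> {0..q / (q - 1)}"
           "e n \<in> {0, 1, q}" "remainder q e x (Suc n) \<in> {0..q / (q - 1)}"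
        using de unfolding expansion_iff_remainder by blast+
      then have "d n = e n" using step[OF r(2)] r(1) by (metis Diff_iff remainder.simps(2) singletonD)
      with r show ?case by simp
    qed
    then show "d n = e n" for n by simp
  qed
  moreover have "q_expansions q x \<noteq> {}"
    using V(1) _ V(2) by (rule expansion_exists) (use step in blast)
  ultimately show ?thesis by (metis ex_in_conv is_singletonI')
qed

lemma expansion_unique_0: "is_singleton (q_expansions q 0)"
  by (rule expansion_unique[where V = "{0}"]) (use q in auto)

lemma expansion_unique_top: "is_singleton (q_expansions q (q / (q - 1)))"
proof -
  have *: "q * (q / (q - 1)) - q = q / (q - 1)" using q by (simp add: field_simps)
  have "\<exists>a\<in>{0, 1, q}. q * x - a \<in> {q / (q - 1)} \<and>
          (\<forall>b\<in>{0, 1, q} - {a}. q * x - b \<notin> {0..q / (q - 1)})" if "x \<in> {q / (q - 1)}" for x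
    using that q * by (intro bexI[of _ q]) auto
  then show ?thesis by (intro expansion_unique[where V = "{q / (q - 1)}"]) (use q in auto)
qed

subsection \<open>A continuum of expansions\<close>

text \<open>One set of naturals codes a sequence: its even members mark the positions of the digit
  1, its odd members those of q.\<close>

lemma digit_sequences_lepoll:
  "{d :: nat \<Rightarrow> real. \<forall>i. d i \<in> {0, 1, q}} \<lesssim> Pow (UNIV :: nat set)"
proof -
  have "inj_on (\<lambda>d. (*) 2 ` {i. d i = 1} \<union> (\<lambda>i. Suc (2 * i)) ` {i. d i = q})
          {d :: nat \<Rightarrow> real. \<forall>i. d i \<in> {0, 1, q}}" (is "inj_on ?f _")
  proof (rule inj_onI)
    have *: "2 * i \<in> ?f d \<longleftrightarrow> d i = 1" "Suc (2 * i) \<in> ?f d \<longleftrightarrow> d i = q" for d :: "nat \<Rightarrow> real" and i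
      by (auto simp: image_iff) presburger+
    fix d e :: "nat \<Rightarrow> real"
    assume de: "d \<in> {d. \<forall>i. d i \<in> {0, 1, q}}" "e \<in> {d. \<forall>i. d i \<in> {0, 1, q}}"
      and "?f d = ?f e"
    then have iff: "d i = 1 \<longleftrightarrow> e i = 1" "d i = q \<longleftrightarrow> e i = q" for i
      using *[of i d] *[of i e] by simp_all
    show "d = e"
    proof
      fix i
      have "d i \<in> {0, 1, q}" "e i \<in> {0, 1, q}" using de by blast+
      then show "d i = e i" using iff[of i] by auto
    qed
  qed
  then show ?thesis by (auto simp: lepoll_def)
qed

text \<open>The block \<open>10\<close> has the same value as \<open>0q\<close>, so the blocks of \<open>(10)\<^sup>\<infinity>\<close> may be exchanged freely.\<close>

lemma continuum_expansions: "q_expansions q (q / (q\<^sup>2 - 1)) \<approx> Pow (UNIV :: nat set)"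
proof (rule lepoll_antisym)
  have "q_expansions q (q / (q\<^sup>2 - 1)) \<subseteq> {d. \<forall>i. d i \<in> {0, 1, q}}"
    by (auto simp: q_expansions_def)
  then show "q_expansions q (q / (q\<^sup>2 - 1)) \<lesssim> Pow (UNIV :: nat set)"
    using digit_sequences_lepoll subset_imp_lepoll lepoll_trans by blast
next
  define x where "x = q / (q\<^sup>2 - 1)"
  \<comment> \<open>Block n of \<open>f A\<close> is 10 if n lies in \<open>A\<close> and 0q
    otherwise.\<close>
  define f :: "nat set \<Rightarrow> nat \<Rightarrow> real" where
    "f A i = (if even i then (if i div 2 \<in> A then 1 else 0) else (if i div 2 \<in> A then 0 else q))" for A i
  have q2: "q\<^sup>2 > 1" using q by (simp add: one_less_power)
  \<comment> \<open>Both blocks return to \<open>x\<close>, because q (q x - 1) = q (q x) - q = x;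
    this equation determines the value of \<open>x\<close>.\<close>
  have r: "remainder q (f A) x (2 * n) = x" for A n
  proof (induction n)
    case (Suc n)
    then show ?case using q2
      by (simp add: f_def) (simp add: x_def field_simps power2_eq_square)
  qed simp
  have b: "0 \<le> x" "x \<le> q / (q - 1)" "0 \<le> q * x - 1" "q * x \<le> q / (q - 1)"
    using q q2 unfolding x_def by (auto simp: divide_simps power2_eq_square algebra_simps)
  have "remainder q (f A) x n \<in> {0..q / (q - 1)}" for A n
  proof (cases "even n")
    case True
    then show ?thesis using r b by (auto elim!: evenE)
  next
    case False
    then obtain m where "n = Suc (2 * m)" by (auto elim!: oddE)
    then show ?thesis using r[of A m] b by (auto simp: f_def)
  qed
  then have "f A \<in> q_expansions q x" for A
    unfolding expansion_iff_remainder by (auto simp: f_def)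
  moreover have "inj f"
  proof (rule injI)
    fix A B assume "f A = f B"
    then have "f A (2 * i) = f B (2 * i)" for i by simp
    then have "i \<in> A \<longleftrightarrow> i \<in> B" for i
      by (metis (no_types) f_def dvd_triv_left nonzero_mult_div_cancel_left zero_neq_numeral zero_neq_one)
    then show "A = B" by blast
  qed
  ultimately have "inj f \<and> range f \<subseteq> q_expansions q x" by blast
  then show "Pow (UNIV :: nat set) \<lesssim> q_expansions q (q / (q\<^sup>2 - 1))"
    unfolding lepoll_def x_def Pow_UNIV by (rule exI[of _ f])
qed

subsection \<open>Countably many expansions\<close>

text \<open>Since \<open>0q = 10\<close>, the word \<open>0q\<^sup>\<infinity>\<close> can be rewritten to \<open>1\<^sup>n0q\<^sup>\<infinity>\<close> for every \<open>n\<close>.\<close>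

lemma countable_infinite_expansions:
  assumes "2 \<le> q"
  shows "q_expansions q (1 / (q - 1)) \<approx> (UNIV :: nat set)"
proof -
  define x where "x = 1 / (q - 1)"
  \<comment> \<open>\<open>x\<close> is the fixed point of the digit 1, and the digit 0 sends it to
    the right endpoint, where only q^oo is possible.\<close>
  have x0: "q * x = q / (q - 1)" and x1: "q * x - 1 = x"
    using q by (simp_all add: x_def field_simps)
  \<comment> \<open>Here q >= 2 enters: the digit q leads nowhere, or for q = 2 to the point 0 with
    its single expansion.\<close>
  have xq: "q * x - q \<le> 0"
    using q assms by (simp add: x_def field_simps)
  define A where "A = case_nat 0 ` q_expansions q (q * x) \<union> case_nat q ` q_expansions q (q * x - q)"
  have fin_top: "finite (q_expansions q (q * x))" "card (q_expansions q (q * x)) = 1"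
    unfolding x0 using expansion_unique_top by (auto simp: is_singleton_altdef intro: card_ge_0_finite)
  have "finite (q_expansions q (q * x - q))"
  proof (cases "q * x - q = 0")
    case True
    then show ?thesis using expansion_unique_0 by (auto simp: is_singleton_def)
  next
    case False
    then show ?thesis using xq no_expansions[of "q * x - q"] by simp
  qed
  then have "finite A" using fin_top by (simp add: A_def)
  have decomp: "q_expansions q x = case_nat 1 ` q_expansions q x \<union> A"
    unfolding A_def by (subst expansions_decompose) (auto simp: x1)
  \<comment> \<open>An expansion other than 1^oo has a digit different from 1 at some position n;
    stripping leading ones reaches an element of \<open>A\<close> after at most n steps.\<close>
  have "d n \<noteq> 1 \<Longrightarrow> d \<in> q_expansions q x \<Longrightarrow> d \<in> (\<Union>m. (case_nat 1 ^^ m) ` A)" for d n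
  proof (induction n arbitrary: d)
    case 0
    then have "d \<in> A" by (subst (asm) decomp) auto
    then show ?case by (intro UN_I[of 0]) auto
  next
    case (Suc n)
    show ?case
    proof (cases "d \<in> A")
      case True
      then show ?thesis by (intro UN_I[of 0]) auto
    next
      case False
      then obtain e where e: "e \<in> q_expansions q x" "d = case_nat 1 e"
        using Suc.prems by (subst (asm) decomp) auto
      then obtain m a where "a \<in> A" "e = (case_nat 1 ^^ m) a"
        using Suc.prems(1) Suc.IH[of e] by auto
      then show ?thesis using e by (intro UN_I[of "Suc m"]) auto
    qed
  qed
  then have "q_expansions q x \<subseteq> insert (\<lambda>_. 1) (\<Union>m. (case_nat 1 ^^ m) ` A)"
    by blast
  moreover have "countable (insert (\<lambda>_. 1) (\<Union>m. (case_nat 1 ^^ m) ` A))"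
    using \<open>finite A\<close> by (intro countable_insert countable_UN countable_image) (auto intro: countable_finite)
  ultimately have "countable (q_expansions q x)" by (rule countable_subset)
  moreover have "infinite (q_expansions q x)"
  proof
    \<comment> \<open>Counting by first digit, the digit 1 alone contributes as many expansions as
      \<open>x\<close> has, and the digit 0 adds one more.\<close>
    assume "finite (q_expansions q x)"
    then show False
      using card_expansions(2)[OF finite_expansions_child, of x] fin_top x1 by simp
  qed
  ultimately show ?thesis
    unfolding eqpoll_def x_def by (metis countableE_infinite)
qed

subsection \<open>Finitely many expansions above the critical base\<close>

abbreviation has_count :: "real \<Rightarrow> nat \<Rightarrow> bool" where
  "has_count x n \<equiv> finite (q_expansions q x) \<and> card (q_expansions q x) = n"

lemma has_count_1_iff: "has_count x 1 \<longleftrightarrow> is_singleton (q_expansions q x)"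
  by (auto simp: is_singleton_altdef intro: card_ge_0_finite)

lemma has_count_0: "x < 0 \<or> q / (q - 1) < x \<Longrightarrow> has_count x 0"
  using no_expansions[of x] by auto

lemma has_count_add:
  assumes "has_count (q * x) k" "has_count (q * x - 1) l" "has_count (q * x - q) m"
  shows "has_count x (k + l + m)"
proof -
  have "finite (q_expansions q (q * x - a))" if "a \<in> {0, 1, q}" for a
    using assms that by fastforce
  from card_expansions[OF this] show ?thesis using assms by simp
qed

text \<open>The point is the value of \<open>(1\<^sup>n q)\<^sup>\<infinity>\<close> for large \<open>n\<close>. In the coordinate
  \<open>x - 1 / (q - 1)\<close>, whose origin is the fixed point of the digit \<open>1\<close>, its orbit is
  \<open>\<epsilon>, q \<epsilon>, \<dots>, q\<^sup>n \<epsilon>\<close> with \<open>\<epsilon> = (q - 1) / (q\<^sup>n\<^sup>+\<^sup>1 - 1)\<close>.\<close>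

lemma unique_point_exists:
  assumes "2 < q" "1 < q * (q - 1) * (q - 2)"
  shows "\<exists>t. 1 / (q - 1) < t \<and> t < 1 \<and> is_singleton (q_expansions q t)"
proof -
  \<comment> \<open>This is q (q - 1) (q - 2) - 1, split in the way it arises when
    \<open>w m < 1\<close> is cleared of denominators; \<open>m\<close> is chosen to satisfy that
    inequality.\<close>
  define \<delta> where "\<delta> = q\<^sup>2 * (q - 2) - (q - 1)\<^sup>2"
  have "\<delta> > 0" using assms(2) by (simp add: \<delta>_def power2_eq_square algebra_simps)
  obtain m where "q\<^sup>2 * (q - 2) / \<delta> < q ^ m"
    using real_arch_pow[OF q] by blast
  also have "q ^ m \<le> q ^ (m + 2)" using q by (intro power_increasing) auto
  finally have Q: "q\<^sup>2 * (q - 2) < q ^ (m + 2) * \<delta>"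
    using \<open>\<delta> > 0\<close> by (simp add: field_simps)
  \<comment> \<open>The number of ones in the period is m + 1: the points \<open>w 0\<close>, ...,
    \<open>w m\<close> use the digit 1, and \<open>w (Suc m)\<close> uses q and returns to
    \<open>w 0\<close>. The return amounts to
    \<open>Q * \<epsilon> = q - 1 + \<epsilon>\<close>.\<close>
  define Q where "Q = q ^ (m + 2)"
  define \<epsilon> where "\<epsilon> = (q - 1) / (Q - 1)"
  define w where "w j = 1 / (q - 1) + q ^ j * \<epsilon>" for j
  have Q1: "Q > 1" using q by (simp add: Q_def one_less_power del: power_add_numeral power_add_numeral2 power_Suc)
  have eps: "\<epsilon> > 0" using Q1 q by (simp add: \<epsilon>_def)
  have Qeps: "Q * \<epsilon> = q - 1 + \<epsilon>"
    using Q1 by (simp add: \<epsilon>_def field_simps)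
  have "Q * (q - 1)\<^sup>2 < q\<^sup>2 * (q - 2) * (Q - 1)"
    using Q unfolding \<delta>_def Q_def[symmetric] by (simp add: algebra_simps)
  then have "(q - 1)\<^sup>2 * (Q / (Q - 1)) < q\<^sup>2 * (q - 2)"
    using Q1 by (simp add: field_simps)
  moreover have "Q = q\<^sup>2 * q ^ m" by (simp add: Q_def power_add power2_eq_square)
  ultimately have "q\<^sup>2 * ((q - 1) * (q ^ m * \<epsilon>)) < q\<^sup>2 * (q - 2)"
    by (simp add: \<epsilon>_def power2_eq_square algebra_simps)
  then have "(q - 1) * (q ^ m * \<epsilon>) < q - 2"
    using q by (simp add: mult_less_cancel_left)
  then have "q ^ m * \<epsilon> < (q - 2) / (q - 1)"
    using q by (simp add: field_simps)
  moreover have "(q - 2) / (q - 1) = 1 - 1 / (q - 1)"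
    using q by (simp add: field_simps)
  ultimately have wm: "w m < 1" by (simp add: w_def)
  have w_le: "w j \<le> w k" if "j \<le> k" for j k
    using that q eps by (auto simp: w_def intro!: mult_right_mono power_increasing)
  have w_lt1: "w j < 1" if "j \<le> m" for j
    using wm w_le[OF that] by simp
  have w_gt: "w j > 1 / (q - 1)" for j
    using q eps by (simp add: w_def)
  have w_Suc: "q * w j - 1 = w (Suc j)" for j
    using q by (simp add: w_def field_simps)
  have "w (Suc (Suc m)) = 1 / (q - 1) + Q * \<epsilon>"
    by (simp add: w_def Q_def)
  then have w_last: "q * w (Suc m) - q = w 0"
    using w_Suc[of "Suc m"] Qeps by (simp add: w_def)
  have top: "q / (q - 1) = 1 + 1 / (q - 1)" "q / (q - 1) < q"
    using q assms(1) by (simp_all add: field_simps)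
  have pos: "1 / (q - 1) > 0" using q by simp
  have "is_singleton (q_expansions q (w 0))"
  proof (rule expansion_unique[where V = "w ` {..Suc m}"])
    have "w j \<in> {0..q / (q - 1)}" if "j \<le> Suc m" for j
    proof -
      have "q * (q / (q - 1)) = q + q / (q - 1)" using q by (simp add: field_simps)
      then have "q * w (Suc m) < q * (q / (q - 1))"
        using w_last w_lt1[of 0] top pos by linarith
      then have "w (Suc m) < q / (q - 1)" by (rule mult_left_less_imp_less) (use q in simp)
      moreover have "0 < w j" using w_gt[of j] pos by linarith
      ultimately show ?thesis using w_le[OF that] by simp
    qed
    then show "w ` {..Suc m} \<subseteq> {0..q / (q - 1)}" by auto
  next
    fix x assume "x \<in> w ` {..Suc m}"
    then obtain j where j: "j \<le> Suc m" "x = w j" by auto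
    have "1 / (q - 1) < w j" by (rule w_gt)
    then have x0: "q * x > q / (q - 1)"
      using q j(2) mult_strict_left_mono[of "1 / (q - 1)" "w j" q] by simp
    show "\<exists>a\<in>{0, 1, q}. q * x - a \<in> w ` {..Suc m} \<and>
            (\<forall>b\<in>{0, 1, q} - {a}. q * x - b \<notin> {0..q / (q - 1)})"
    proof (cases "j \<le> m")
      case True
      then have "q * x < q * 1" using j w_lt1[of j] q by (intro mult_strict_left_mono) auto
      moreover have "q * x - 1 \<in> w ` {..Suc m}" using w_Suc[of j] j True by auto
      ultimately show ?thesis using x0 by (intro bexI[of _ 1]) auto
    next
      case False
      then have "q * x - q = w 0" using j w_last by (simp add: le_Suc_eq)
      moreover from this have "q * x - 1 > q / (q - 1)"
        using w_gt[of 0] top assms(1) by simp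
      moreover have "w 0 \<in> w ` {..Suc m}" by blast
      ultimately show ?thesis using x0 by (intro bexI[of _ q]) auto
    qed
  qed auto
  then show ?thesis using w_gt[of 0] w_lt1[of 0] by auto
qed

text \<open>For \<open>t\<close> as above, \<open>0 q\<^sup>k t\<close> has precisely the \<open>k + 1\<close> expansions \<open>1\<^sup>i 0 q\<^sup>k\<^sup>-\<^sup>i t\<close>.\<close>

lemma finitely_many_expansions:
  assumes "2 < q" "1 < q * (q - 1) * (q - 2)"
  shows "\<exists>x. has_count x (Suc k)"
proof -
  obtain t where t: "1 / (q - 1) < t" "t < 1" "has_count t 1"
    using unique_point_exists[OF assms] unfolding has_count_1_iff by blast
  \<comment> \<open>\<open>s j\<close> is the value of q^j t, since prepending the digit q is the
    map y -> (y + q) / q.\<close>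
  define s where "s j = ((\<lambda>y. y / q + 1) ^^ j) t" for j
  have s0: "s 0 = t" and s_Suc: "s (Suc j) = s j / q + 1" for j by (simp_all add: s_def)
  have top: "q / (q - 1) = 1 + 1 / (q - 1)" "q / (q - 1) < q" "1 / (q - 1) < 1" "0 < 1 / (q - 1)"
    using q assms(1) by (simp_all add: field_simps)
  \<comment> \<open>Prepending q keeps the expansion unique: the digits 0 and 1 would send
    \<open>s (Suc j)\<close> beyond the right endpoint.\<close>
  have s: "has_count (s j) 1 \<and> 1 / (q - 1) < s j \<and> s j \<le> q / (q - 1)" for j
  proof (induction j)
    case 0
    have "t \<le> q / (q - 1)" using t top by linarith
    then show ?case using t by (simp add: s0)
  next
    case (Suc j)
    have e: "q * s (Suc j) = s j + q" using q by (simp add: s_Suc field_simps)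
    have "has_count (s (Suc j)) (0 + 0 + 1)"
      by (rule has_count_add; unfold e) (use Suc top assms(1) in \<open>auto intro!: has_count_0\<close>)
    moreover have "0 < s j" using Suc top by linarith
    then have "0 < s j / q" using q by simp
    then have "1 / (q - 1) < s (Suc j)" unfolding s_Suc using top by linarith
    ultimately show ?case using expansion_bounds(2)[of _ "s (Suc j)"] by fastforce
  qed
  have "has_count (s k / q) (Suc k)"
  proof (induction k)
    case 0
    have e: "q * (s 0 / q) = t" using q by (simp add: s0)
    have "has_count (s 0 / q) (1 + 0 + 0)"
      by (rule has_count_add; unfold e) (use t q in \<open>auto intro!: has_count_0\<close>)
    then show ?case by simp
  next
    case (Suc k)
    \<comment> \<open>The second equation is 0q = 10: after the digit 1 the value of 0 q^k t
      remains, so the digit 0 adds one expansion to those already counted.\<close>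
    have e: "q * (s (Suc k) / q) = s (Suc k)" "s (Suc k) - 1 = s k / q"
      using q by (simp_all add: s_Suc)
    have "has_count (s (Suc k) / q) (1 + Suc k + 0)"
      by (rule has_count_add; unfold e) (use s[of "Suc k"] Suc top in \<open>auto intro!: has_count_0\<close>)
    then show ?case by simp
  qed
  then show ?thesis by blast
qed

section \<open>Uniqueness after one digit, and splicing of expansions\<close>

lemma unique_child:
  assumes "is_singleton (q_expansions q x)" "a \<in> {0, 1, q}" "q_expansions q (q * x - a) \<noteq> {}"
  shows "is_singleton (q_expansions q (q * x - a))"
proof -
  have "case_nat a ` q_expansions q (q * x - a) \<subseteq> q_expansions q x"
    using assms(2) expansions_decompose[of x] by auto
  moreover obtain f where "q_expansions q x = {f}" using assms(1) by (auto simp: is_singleton_def)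
  ultimately have "case_nat a d = case_nat a e"
    if "d \<in> q_expansions q (q * x - a)" "e \<in> q_expansions q (q * x - a)" for d e
    using that by auto
  then have "d = e" if "d \<in> q_expansions q (q * x - a)" "e \<in> q_expansions q (q * x - a)" for d e
    using that injD[OF inj_case_nat[of a], of d e] by blast
  then show ?thesis using assms(3) by (intro is_singletonI') auto
qed

lemma not_unique_if_two_children:
  assumes "a \<in> {0, 1, q}" "b \<in> {0, 1, q}" "a \<noteq> b"
    "q_expansions q (q * x - a) \<noteq> {}" "q_expansions q (q * x - b) \<noteq> {}"
  shows "\<not> is_singleton (q_expansions q x)"
proof
  assume *: "is_singleton (q_expansions q x)"
  obtain d e where "d \<in> q_expansions q (q * x - a)" "e \<in> q_expansions q (q * x - b)"
    using assms by blast
  then have "case_nat a d \<in> q_expansions q x" "case_nat b e \<in> q_expansions q x"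
    using assms expansions_decompose[of x] by auto
  then have "case_nat a d = case_nat b e" using * by (auto simp: is_singleton_def)
  then have "case_nat a d 0 = case_nat b e 0" by simp
  then show False using assms(3) by simp
qed

text \<open>Up to position l the remainders are those of \<open>d\<close>, afterwards those of
  \<open>e\<close>, so all stay in the interval. The diagonal argument uses this to change an
  expansion behind a fixed prefix.\<close>

lemma splice_expansion:
  assumes "d \<in> q_expansions q x" "e \<in> q_expansions q (remainder q d x l)"
  shows "(\<lambda>i. if i < l then d i else e (i - l)) \<in> q_expansions q x" (is "?f \<in> _")
    and "remainder q (\<lambda>i. if i < l then d i else e (i - l)) x (l + m) =
           remainder q e (remainder q d x l) m"
proof -
  have low: "remainder q ?f x n = remainder q d x n" if "n \<le> l" for n
    using that by (intro remainder_cong) auto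
  have "(\<lambda>i. ?f (l + i)) = e" by auto
  then have high: "remainder q ?f x (l + n) = remainder q e (remainder q d x l) n" for n
    unfolding remainder_add low[OF order_refl] by simp
  then show "remainder q ?f x (l + m) = remainder q e (remainder q d x l) m" .
  have "remainder q ?f x n \<in> {0..q / (q - 1)}" for n
  proof (cases "n \<le> l")
    case True
    then show ?thesis using low assms(1) unfolding expansion_iff_remainder by auto
  next
    case False
    then obtain k where "n = l + k" by (metis le_add_diff_inverse nle_le)
    then show ?thesis using high assms(2) unfolding expansion_iff_remainder by auto
  qed
  moreover have "?f i \<in> {0, 1, q}" for i
    using assms unfolding expansion_iff_remainder by auto
  ultimately show "?f \<in> q_expansions q x"
    unfolding expansion_iff_remainder by blast
qed

end

subsection \<open>Bases up to the critical one\<close>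

text \<open>For q > 1 the right end is q / (q - 1); this form makes comparisons linear in 1 / (q -
  1).\<close>

definition interior_points :: "real \<Rightarrow> real set" where
  "interior_points q = {0<..<1 + 1 / (q - 1)}"

context
  fixes q :: real
  assumes q: "1 < q" and q_le: "q \<le> q_c"
begin

text \<open>Two polynomial inequalities in several guises. The first, fourth and eighth facts say (q
  - 1) (q - 2) < 1, which makes the regions of the digits 1 and q overlap; the third and the last
  say q (q - 1) (q - 2) <= 1.\<close>

lemma critical_facts:
  shows "q * q < 3 * q - 1"
    and "q / (q - 1) = 1 + 1 / (q - 1)"
    and "1 / q \<le> 1 / (q - 1) + 2 - q"
    and "1 < 1 / (q - 1) + 1 / q"
    and "0 < 1 / q" "1 / q < 1" "1 / q < 1 / (q - 1)"
    and "q - 1 < 1 + 1 / (q - 1)"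
    and "q\<^sup>2 * (q - 2) / (q - 1) \<le> q - 1"
proof -
  \<comment> \<open>Any upper bound b of \<open>q_c\<close> with (b - 1) (b - 2) < 1 would
    do.\<close>
  have lt: "q < 2.33" using q_le q_c_approx by simp
  have "(q - 1) * (q - 2) < 1"
  proof (cases "q \<le> 2")
    case True
    then have "(q - 1) * (q - 2) \<le> 0" using q by (intro mult_nonneg_nonpos) auto
    then show ?thesis by simp
  next
    case False
    then have "(q - 1) * (q - 2) \<le> 1.33 * 0.33" using lt by (intro mult_mono) auto
    then show ?thesis by simp
  qed
  then show qq: "q * q < 3 * q - 1" by (simp add: algebra_simps)
  show "q / (q - 1) = 1 + 1 / (q - 1)" using q by (simp add: field_simps)
  have p: "q * (q - 1) * (q - 2) \<le> 1" by (rule product_le_1[OF q q_le])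
  have "1 / (q - 1) + 2 - q - 1 / q = (1 - q * (q - 1) * (q - 2)) / (q * (q - 1))"
    using q by (simp add: field_simps)
  also have "\<dots> \<ge> 0" using p q by (intro divide_nonneg_pos) auto
  finally show "1 / q \<le> 1 / (q - 1) + 2 - q" by simp
  show "1 < 1 / (q - 1) + 1 / q" "0 < 1 / q" "1 / q < 1" "1 / q < 1 / (q - 1)"
    "q - 1 < 1 + 1 / (q - 1)"
    using qq q by (simp_all add: field_simps)
  show "q\<^sup>2 * (q - 2) / (q - 1) \<le> q - 1"
    using p q by (simp add: field_simps power2_eq_square)
qed

lemma scale_less: "a < b / q \<Longrightarrow> q * a < b" "a / q < b \<Longrightarrow> a < q * b"
  "a \<le> b / q \<Longrightarrow> q * a \<le> b" "a / q \<le> b \<Longrightarrow> a \<le> q * b"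
  using q by (simp_all add: field_simps)

lemma scale_fixed: "q * (1 / (q - 1)) = 1 + 1 / (q - 1)" "q * (1 / (q - 1) + 1 / q) = 2 + 1 / (q - 1)"
  using q by (simp_all add: field_simps)

lemma scale_mono: "a < b \<Longrightarrow> q * a < q * b" "a \<le> b \<Longrightarrow> q * a \<le> q * b"
  using q by simp_all

text \<open>The regions [0, 1/(q-1)], [1/q, 1/(q-1) + 1/q] and [1, 1 + 1/(q-1)] of the digits 0, 1
  and q cover the interval, so some digit always keeps the orbit inside.\<close>

lemma expansion_exists_interval:
  assumes "0 \<le> x" "x \<le> 1 + 1 / (q - 1)"
  shows "q_expansions q x \<noteq> {}"
proof (rule expansion_exists[OF q, where V = "{0..q / (q - 1)}"])
  fix x assume x: "x \<in> {0..q / (q - 1)}"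
  consider "x \<le> 1 / (q - 1)" | "1 / (q - 1) < x" "x \<le> 1 / (q - 1) + 1 / q" | "1 / (q - 1) + 1 / q < x"
    by linarith
  then show "\<exists>a\<in>{0, 1, q}. q * x - a \<in> {0..q / (q - 1)}"
  proof cases
    case 1
    then show ?thesis using x scale_mono(2)[OF 1] scale_fixed critical_facts(2) q by auto
  next
    case 2
    have "1 \<le> q * x" using 2 critical_facts by (intro scale_less) linarith
    then show ?thesis using scale_mono(2)[OF 2(2)] scale_fixed critical_facts(2) q
      by (intro bexI[of _ 1]) auto
  next
    case 3
    have "q * 1 \<le> q * x" using 3 critical_facts by (intro scale_mono) linarith
    moreover have "q * x \<le> q * (1 + 1 / (q - 1))"
      using x critical_facts(2) by (intro scale_mono) simp
    ultimately show ?thesis using scale_fixed critical_facts(2)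
      by (intro bexI[of _ q]) (auto simp: distrib_left)
  qed
qed (use assms critical_facts(2) in auto)

lemma expansion_exists_interior: "x \<in> interior_points q \<Longrightarrow> q_expansions q x \<noteq> {}"
  by (rule expansion_exists_interval) (auto simp: interior_points_def)

lemma child_interior:
  shows "0 < x \<Longrightarrow> x < 1 / (q - 1) \<Longrightarrow> q * x \<in> interior_points q"
    and "1 / q < x \<Longrightarrow> x < 1 / (q - 1) + 1 / q \<Longrightarrow> q * x - 1 \<in> interior_points q"
    and "1 < x \<Longrightarrow> x < 1 + 1 / (q - 1) \<Longrightarrow> q * x - q \<in> interior_points q"
  using q scale_mono(1)[of x "1 / (q - 1)"] scale_mono(1)[of x "1 / (q - 1) + 1 / q"]
    scale_mono(1)[of x "1 + 1 / (q - 1)"] scale_less(2)[of 1 x] scale_fixed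
  by (auto simp: interior_points_def distrib_left)

definition unique_interior :: "real set" where
  "unique_interior = {x \<in> interior_points q. is_singleton (q_expansions q x)}"

text \<open>Since every point of the closed interval has an expansion, a point in two digit regions
  is not unique; the cases are what the overlaps leave. The middle case is void for q <= 2.\<close>

lemma unique_interior_step:
  assumes "x \<in> unique_interior"
  obtains (low) "0 < x" "x < 1 / q" "q * x \<in> unique_interior"
  | (middle) "1 / (q - 1) < x" "x < 1" "q * x - 1 \<in> unique_interior"
  | (high) "1 / (q - 1) + 1 / q < x" "x < 1 + 1 / (q - 1)" "q * x - q \<in> unique_interior"
proof -
  have x: "0 < x" "x < 1 + 1 / (q - 1)" and uniq: "is_singleton (q_expansions q x)"
    using assms by (auto simp: unique_interior_def interior_points_def)
  have child: "q * x - a \<in> unique_interior" if "a \<in> {0, 1, q}" "q * x - a \<in> interior_points q" for a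
    using that unique_child[OF q uniq] expansion_exists_interior by (simp add: unique_interior_def)
  have two: "False" if "a \<in> {0, 1, q}" "b \<in> {0, 1, q}" "a \<noteq> b"
      "0 \<le> q * x - a" "q * x - a \<le> 1 + 1 / (q - 1)" "0 \<le> q * x - b" "q * x - b \<le> 1 + 1 / (q - 1)" for a b
    using not_unique_if_two_children[OF q that(1-3)] uniq that(4-) expansion_exists_interval by blast
  consider "x < 1 / q" | "1 / q \<le> x" "x \<le> 1 / (q - 1)" | "1 / (q - 1) < x" "x < 1"
    | "1 \<le> x" "1 / (q - 1) < x" "x \<le> 1 / (q - 1) + 1 / q" | "1 / (q - 1) + 1 / q < x"
    by linarith
  then show thesis
  proof cases
    case 1
    then have "q * x \<in> interior_points q" using critical_facts x by (intro child_interior) linarith+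
    then show ?thesis using low 1 x child[of 0] by simp
  next
    case 2
    then have "1 \<le> q * x" "q * x \<le> 1 + 1 / (q - 1)"
      using scale_less(4) scale_mono(2)[of x "1 / (q - 1)"] scale_fixed by auto
    then show ?thesis using two[of 0 1] x q by auto
  next
    case 3
    then have "q * x - 1 \<in> interior_points q" using critical_facts x by (intro child_interior) linarith+
    then show ?thesis using middle 3 x child[of 1] by simp
  next
    case 4
    then have "q \<le> q * x" "q * x \<le> 2 + 1 / (q - 1)"
      using scale_mono(2)[of 1 x] scale_mono(2)[of x "1 / (q - 1) + 1 / q"] scale_fixed by auto
    then show ?thesis using two[of 1 q] q by auto
  next
    case 5
    then have "q * x - q \<in> interior_points q" using critical_facts x by (intro child_interior) linarith+
    then show ?thesis using high 5 x child[of q] by simp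
  qed
qed

text \<open>An orbit without branching leaves the region of the digit \<open>0\<close> (or \<open>q\<close>) into that of
  the digit \<open>1\<close>, leaves that one into the region of the digit \<open>q\<close>, and is thereby
  sent below \<open>1 / (q - 1)\<close> but not below \<open>1 / q\<close>; both estimates amount to
  \<open>q (q - 1) (q - 2) \<le> 1\<close>.\<close>

lemma unique_interior_empty: "unique_interior = {}"
proof -
  have middle_impossible: False if x: "x \<in> unique_interior" "1 / (q - 1) < x" "x < 1" for x
  proof -
    have c: "1 - 1 / (q - 1) > 0" using x by linarith
    \<comment> \<open>z is the distance from the fixed point 1 / (q - 1) of the digit 1, multiplied
      by q while the point stays at most 1.\<close>
    have "\<exists>z. z + 1 / (q - 1) \<in> unique_interior \<and> 1 - 1 / (q - 1) < z \<and> z \<le> q * (1 - 1 / (q - 1))"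
    proof (rule scaling_escape[OF q, where z = "x - 1 / (q - 1)"])
      fix z assume "z + 1 / (q - 1) \<in> unique_interior" and z: "0 < z" "z \<le> 1 - 1 / (q - 1)"
      then show "q * z + 1 / (q - 1) \<in> unique_interior"
      proof (cases rule: unique_interior_step)
        case middle
        then show ?thesis using scale_fixed by (simp add: distrib_left)
      qed (use critical_facts in linarith)+
    qed (use x in auto)
    then obtain z where z: "z + 1 / (q - 1) \<in> unique_interior" "1 - 1 / (q - 1) < z"
      "z \<le> q * (1 - 1 / (q - 1))" by blast
    from z(1) show False
    proof (cases rule: unique_interior_step)
      case high
      \<comment> \<open>The escape bound puts the next point into (1/q, 1/(q-1)], inside the overlap
        of the regions of 0 and 1.\<close>
      have "q * z \<le> q * (q * (1 - 1 / (q - 1)))" using z(3) by (rule scale_mono)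
      also have "\<dots> = q\<^sup>2 * (q - 2) / (q - 1)" using q by (simp add: field_simps power2_eq_square)
      finally have "q * z \<le> q - 1" using critical_facts by linarith
      then have le: "q * (z + 1 / (q - 1)) - q \<le> 1 / (q - 1)"
        using scale_fixed by (simp add: distrib_left)
      have "2 + 1 / (q - 1) < q * (z + 1 / (q - 1))"
        using scale_mono(1)[OF high(1)] scale_fixed by simp
      then have gt: "1 / q < q * (z + 1 / (q - 1)) - q" using critical_facts by linarith
      from high(3) show False
        by (cases rule: unique_interior_step) (use le gt critical_facts in linarith)+
    qed (use z critical_facts in linarith)+
  qed
  have low_impossible: False if x: "x \<in> unique_interior" "x < 1 / q" for x
  proof -
    have "\<exists>y. y \<in> unique_interior \<and> 1 / q < y \<and> y \<le> q * (1 / q)"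
    proof (rule scaling_escape[OF q])
      show "0 < x" using x by (auto simp: unique_interior_def interior_points_def)
      fix y assume "y \<in> unique_interior" "0 < y" "y \<le> 1 / q"
      then show "q * y \<in> unique_interior"
        by (cases rule: unique_interior_step) (use critical_facts in \<open>auto simp del: divide_le_0_1_iff\<close>)
    qed (use x in auto)
    then obtain y where y: "y \<in> unique_interior" "1 / q < y" "y \<le> 1" using q by auto
    from y(1) show False
      by (cases rule: unique_interior_step) (use y middle_impossible[OF y(1)] critical_facts in linarith)+
  qed
  have high_impossible: False if x: "x \<in> unique_interior" "1 / (q - 1) + 1 / q < x" for x
  proof -
    \<comment> \<open>y is the distance from the right endpoint, the fixed point of the digit q.
      After the escape the point is still at least 2 + 1/(q-1) - q >= 1/q, so only the middle case
      remains.\<close>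
    have "\<exists>y. 1 + 1 / (q - 1) - y \<in> unique_interior \<and> 1 - 1 / q < y \<and> y \<le> q * (1 - 1 / q)"
    proof (rule scaling_escape[OF q])
      show "1 + 1 / (q - 1) - (1 + 1 / (q - 1) - x) \<in> unique_interior" using x by simp
      show "0 < 1 + 1 / (q - 1) - x" "1 + 1 / (q - 1) - x \<le> 1 - 1 / q"
        using x by (auto simp: unique_interior_def interior_points_def)
      fix y assume "1 + 1 / (q - 1) - y \<in> unique_interior" "0 < y" "y \<le> 1 - 1 / q"
      then show "1 + 1 / (q - 1) - q * y \<in> unique_interior"
      proof (cases rule: unique_interior_step)
        case high
        have "q * (1 + 1 / (q - 1) - y) - q = 1 + 1 / (q - 1) - q * y"
          using scale_fixed by (simp add: algebra_simps)
        then show ?thesis using high by simp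
      qed (use \<open>y \<le> 1 - 1 / q\<close> critical_facts in linarith)+
    qed
    then obtain y where y: "1 + 1 / (q - 1) - y \<in> unique_interior" "1 - 1 / q < y" "y \<le> q - 1"
      using q by (auto simp: algebra_simps)
    from y(1) show False
      by (cases rule: unique_interior_step)
        (use y middle_impossible[OF y(1)] critical_facts in linarith)+
  qed
  show ?thesis
  proof (rule equals0I)
    fix x assume x: "x \<in> unique_interior"
    then show False
      by (cases rule: unique_interior_step) (use middle_impossible low_impossible high_impossible x in auto)
  qed
qed

lemma interior_not_unique: "x \<in> interior_points q \<Longrightarrow> \<not> is_singleton (q_expansions q x)"
  using unique_interior_empty by (auto simp: unique_interior_def)

text \<open>Common leading digits of \<open>d\<close> and \<open>e\<close> are stripped; by the
  first-digit count this never increases the number of expansions. \<open>y\<close> is the remainder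
  at the first position where they differ.\<close>

lemma finite_expansions_branching:
  assumes "finite (q_expansions q x)" "d \<in> q_expansions q x" "e \<in> q_expansions q x" "d n \<noteq> e n"
  shows "\<exists>y. \<exists>a\<in>{0, 1, q}. \<exists>b\<in>{0, 1, q}. a < b \<and> finite (q_expansions q y) \<and>
     card (q_expansions q y) \<le> card (q_expansions q x) \<and>
     q_expansions q (q * y - a) \<noteq> {} \<and> q_expansions q (q * y - b) \<noteq> {}"
  using assms
proof (induction n arbitrary: x d e)
  case 0
  have "d 0 \<in> {0, 1, q}" "e 0 \<in> {0, 1, q}" "q_expansions q (q * x - d 0) \<noteq> {}"
    "q_expansions q (q * x - e 0) \<noteq> {}"
    using 0(2,3) expansion_Suc_iff[OF q] by blast+
  then show ?case using 0 by (metis linorder_neqE_linordered_idom order_refl)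
next
  case (Suc n)
  have de: "d 0 \<in> {0, 1, q}" "e 0 \<in> {0, 1, q}" "(\<lambda>i. d (Suc i)) \<in> q_expansions q (q * x - d 0)"
    "(\<lambda>i. e (Suc i)) \<in> q_expansions q (q * x - e 0)"
    using Suc.prems(2,3) expansion_Suc_iff[OF q] by blast+
  show ?case
  proof (cases "d 0 = e 0")
    case True
    have "finite (q_expansions q (q * x - d 0))"
      using finite_expansions_child[OF q] Suc.prems(1) de(1) by blast
    from Suc.IH[OF this de(3)] obtain y a b where y: "a \<in> {0, 1, q}" "b \<in> {0, 1, q}" "a < b"
        "finite (q_expansions q y)" "card (q_expansions q y) \<le> card (q_expansions q (q * x - d 0))"
        "q_expansions q (q * y - a) \<noteq> {}" "q_expansions q (q * y - b) \<noteq> {}"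
      using de(4) True Suc.prems(4) by metis
    have "card (q_expansions q (q * x - d 0)) \<le> card (q_expansions q x)"
      using card_expansions(2)[OF q finite_expansions_child[OF q Suc.prems(1)]] de(1) by auto
    then show ?thesis using y le_trans by blast
  next
    case False
    then show ?thesis using Suc.prems de by (metis empty_iff linorder_neqE_linordered_idom order_refl)
  qed
qed

text \<open>Induction on the cardinality: at a branching point each child has strictly fewer
  expansions, hence at most one, hence is not interior. The two inhabited children must then be
  endpoints, and no pair of digits allows this.\<close>

lemma finite_expansions_card_le_1:
  "finite (q_expansions q x) \<Longrightarrow> card (q_expansions q x) \<le> 1"
proof (induction "card (q_expansions q x)" arbitrary: x rule: less_induct)
  case less
  show ?case
  proof (rule ccontr)
    assume "\<not> card (q_expansions q x) \<le> 1"
    then obtain d e where de: "d \<in> q_expansions q x" "e \<in> q_expansions q x" "d \<noteq> e"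
      using less.prems by (auto simp: card_le_Suc0_iff_eq)
    then obtain n where "d n \<noteq> e n" by blast
    from finite_expansions_branching[OF less.prems de(1,2) this] obtain y a b where ab: "a \<in> {0, 1, q}" "b \<in> {0, 1, q}" "a < b"
        and fin: "finite (q_expansions q y)" and le: "card (q_expansions q y) \<le> card (q_expansions q x)"
        and ne: "q_expansions q (q * y - a) \<noteq> {}" "q_expansions q (q * y - b) \<noteq> {}"
      by (elim exE bexE conjE) (rule that)
    note child_fin = finite_expansions_child[OF q fin]
    have pos: "card (q_expansions q (q * y - a)) > 0" "card (q_expansions q (q * y - b)) > 0"
      using ne child_fin ab by (auto simp: card_gt_0_iff)
    have sum: "card (q_expansions q y) = card (q_expansions q (q * y))
      + card (q_expansions q (q * y - 1)) + card (q_expansions q (q * y - q))"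
      by (rule card_expansions(2)[OF q child_fin])
    have "card (q_expansions q (q * y - c)) < card (q_expansions q y)" if "c \<in> {0, 1, q}" for c
      using that ab pos sum by auto
    then have "card (q_expansions q (q * y - c)) \<le> 1" if "c \<in> {0, 1, q}" for c
      using that less.hyps child_fin le by (meson less_le_trans)
    then have not_interior: "q * y - c \<notin> interior_points q" if "c \<in> {0, 1, q}" for c
      using that child_fin[OF that] interior_not_unique expansion_exists_interior
      by (metis One_nat_def card_gt_0_iff is_singleton_altdef le_antisym Suc_leI)
    have bounds: "0 \<le> q * y - a" "0 \<le> q * y - b" "q * y - a \<le> 1 + 1 / (q - 1)" "q * y - b \<le> 1 + 1 / (q - 1)"
      using ne expansion_bounds[OF q] critical_facts(2) by fastforce+
    \<comment> \<open>As a < b, the digit b leads to 0 and a to the right endpoint, so b - a is the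
      length of the interval.\<close>
    then have eqs: "q * y = b" "q * y = a + (1 + 1 / (q - 1))"
      using not_interior[OF ab(1)] not_interior[OF ab(2)] ab(3) by (auto simp: interior_points_def)
    have "0 < 1 / (q - 1)" using q by simp
    then have "b = q" using ab eqs q by auto
    have "a = 0 \<or> a = 1" using ab \<open>b = q\<close> by auto
    then show False
    proof
      assume "a = 1"
      then have "q = 2 + 1 / (q - 1)" using eqs \<open>b = q\<close> by simp
      then show False using critical_facts(8) by simp
    next
      \<comment> \<open>These equations are consistent exactly for q = 2; the contradiction comes
        from the remaining digit 1, which leads to the interior point 1 / (q - 1).\<close>
      assume "a = 0"
      then have "q * y - 1 = 1 / (q - 1)" using eqs by simp
      then show False using not_interior[of 1] \<open>0 < 1 / (q - 1)\<close> by (simp add: interior_points_def)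
    qed
  qed
qed

end

subsection \<open>Bases below 2\<close>

context
  fixes q :: real
  assumes q: "1 < q" and q_less: "q < 2"
begin

lemma q_le_q_c: "q \<le> q_c"
  using q_less q_c_approx by simp

lemma one_less: "1 < 1 / (q - 1)"
  using q q_less by (simp add: field_simps)

text \<open>Both remainders are taken at the same position and are interior, so the construction can
  go on behind whichever of the two prefixes is selected.\<close>

definition branching :: "real \<Rightarrow> bool" where
  "branching x \<longleftrightarrow> (\<exists>d\<in>q_expansions q x. \<exists>e\<in>q_expansions q x. \<exists>m. \<exists>j<m. d j \<noteq> e j \<and>
     remainder q d x m \<in> interior_points q \<and> remainder q e x m \<in> interior_points q)"

lemma branching_if_child_branching:
  assumes "branching (q * x - a)" "a \<in> {0, 1, q}"
  shows "branching x"
proof -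
  obtain d e m j where *: "d \<in> q_expansions q (q * x - a)" "e \<in> q_expansions q (q * x - a)" "j < m"
      "d j \<noteq> e j" "remainder q d (q * x - a) m \<in> interior_points q"
      "remainder q e (q * x - a) m \<in> interior_points q"
    using assms(1) unfolding branching_def by blast
  have r: "remainder q (case_nat a f) x (Suc m) = remainder q f (q * x - a) m" for f
    using remainder_add[of q "case_nat a f" x 1 m] by simp
  have "case_nat a d \<in> q_expansions q x" "case_nat a e \<in> q_expansions q x"
    using * assms(2) expansions_decompose[OF q, of x] by auto
  then show ?thesis
    unfolding branching_def using * r by (metis Suc_mono nat.case(2))
qed

lemma branching_if_two_children:
  assumes "a \<in> {0, 1, q}" "b \<in> {0, 1, q}" "a \<noteq> b"
    "q * x - a \<in> interior_points q" "q * x - b \<in> interior_points q"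
  shows "branching x"
proof -
  obtain d e where "d \<in> q_expansions q (q * x - a)" "e \<in> q_expansions q (q * x - b)"
    using assms expansion_exists_interior[OF q q_le_q_c] by blast
  then have "case_nat a d \<in> q_expansions q x" "case_nat b e \<in> q_expansions q x"
    using assms expansions_decompose[OF q, of x] by auto
  moreover have "case_nat a d 0 \<noteq> case_nat b e 0" "(0::nat) < 1"
    "remainder q (case_nat a d) x 1 \<in> interior_points q"
    "remainder q (case_nat b e) x 1 \<in> interior_points q"
    using assms by auto
  ultimately show ?thesis unfolding branching_def by blast
qed

text \<open>For q < 2 all points strictly between 1/q and 1/(q-1) + 1/q have two interior children.
  An orbit that avoids them stays near an end, but its distance from that end grows by the factor
  q.\<close>

lemma interior_branching:
  assumes "x \<in> interior_points q"
  shows "branching x"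
proof (rule ccontr)
  note facts = critical_facts[OF q q_le_q_c]
  note child = child_interior[OF q q_le_q_c]
  define N where "N = {x \<in> interior_points q. \<not> branching x}"
  have child_N: "q * x - a \<in> N" if "x \<in> N" "a \<in> {0, 1, q}" "q * x - a \<in> interior_points q" for x a
    using that branching_if_child_branching by (auto simp: N_def)
  have N: "x \<le> 1 / q \<and> q * x \<in> N \<or> 1 / (q - 1) + 1 / q \<le> x \<and> q * x - q \<in> N" if "x \<in> N" for x
  proof -
    have x: "0 < x" "x < 1 + 1 / (q - 1)"
      using that by (auto simp: N_def interior_points_def)
    consider "x \<le> 1 / q" | "1 / q < x" "x < 1 / (q - 1)"
      | "1 / (q - 1) \<le> x" "x < 1 / (q - 1) + 1 / q" | "1 / (q - 1) + 1 / q \<le> x" by linarith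
    then show ?thesis
    proof cases
      case 1
      then have "q * x \<in> interior_points q" using x facts by (intro child) linarith+
      then show ?thesis using child_N[OF that, of 0] 1 by simp
    next
      case 2
      then have "q * x \<in> interior_points q" "q * x - 1 \<in> interior_points q"
        using x facts by (intro child; linarith)+
      then have "branching x" using branching_if_two_children[of 0 1 x] by simp
      then show ?thesis using that by (simp add: N_def)
    next
      case 3
      then have "q * x - 1 \<in> interior_points q" "q * x - q \<in> interior_points q"
        using x facts one_less by (intro child; linarith)+
      then have "branching x" using branching_if_two_children[of 1 q x] q by simp
      then show ?thesis using that by (simp add: N_def)
    next
      case 4
      then have "q * x - q \<in> interior_points q" using x facts by (intro child) linarith+
      then show ?thesis using child_N[OF that, of q] 4 by simp
    qed
  qed
  have low_impossible: False if x: "x \<in> N" "x \<le> 1 / q" for x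
  proof -
    have "\<exists>y. y \<in> N \<and> 1 / q < y \<and> y \<le> q * (1 / q)"
    proof (rule scaling_escape[OF q])
      show "0 < x" using x by (auto simp: N_def interior_points_def)
      fix y assume "y \<in> N" "0 < y" "y \<le> 1 / q"
      then show "q * y \<in> N" using N[of y] facts by linarith
    qed (use x in auto)
    then obtain y where "y \<in> N" "1 / q < y" "y \<le> 1" using q by auto
    then show False using N[of y] facts by linarith
  qed
  assume "\<not> branching x"
  then have x: "x \<in> N" "1 / (q - 1) + 1 / q \<le> x"
    using assms low_impossible[of x] N[of x] by (auto simp: N_def)
  have "\<exists>y. 1 + 1 / (q - 1) - y \<in> N \<and> 1 - 1 / q < y \<and> y \<le> q * (1 - 1 / q)"
  proof (rule scaling_escape[OF q])
    show "1 + 1 / (q - 1) - (1 + 1 / (q - 1) - x) \<in> N" using x by simp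
    show "0 < 1 + 1 / (q - 1) - x" "1 + 1 / (q - 1) - x \<le> 1 - 1 / q"
      using x by (auto simp: N_def interior_points_def)
    fix y assume y: "1 + 1 / (q - 1) - y \<in> N" "0 < y" "y \<le> 1 - 1 / q"
    then have "q * (1 + 1 / (q - 1) - y) - q \<in> N" using N[OF y(1)] facts by linarith
    moreover have "q * (1 + 1 / (q - 1) - y) - q = 1 + 1 / (q - 1) - q * y"
      using scale_fixed[OF q q_le_q_c] by (simp add: algebra_simps)
    ultimately show "1 + 1 / (q - 1) - q * y \<in> N" by simp
  qed
  then obtain y where y: "1 + 1 / (q - 1) - y \<in> N" "1 - 1 / q < y" "y \<le> q - 1"
    using q by (auto simp: algebra_simps)
  then show False
    using N[OF y(1)] low_impossible[OF y(1)] facts by linarith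
qed

text \<open>Diagonalisation: along a sequence of longer and longer admissible prefixes, the \<open>n\<close>-th
  branching is used to deviate from the \<open>n\<close>-th expansion of a given enumeration.\<close>

lemma uncountable_expansions:
  assumes x: "x \<in> interior_points q"
  shows "uncountable (q_expansions q x)"
proof
  assume "countable (q_expansions q x)"
  moreover have "q_expansions q x \<noteq> {}" by (rule expansion_exists_interior[OF q q_le_q_c x])
  ultimately obtain e :: "nat \<Rightarrow> nat \<Rightarrow> real" where e: "range e = q_expansions q x"
    by (intro that[of "from_nat_into (q_expansions q x)"] range_from_nat_into)
  \<comment> \<open>A state is an expansion of \<open>x\<close> with a prefix length at which its
    remainder is interior; \<open>R n\<close> extends the prefix and makes it differ from
    \<open>e n\<close>.\<close>
  define P where "P s \<longleftrightarrow> fst s \<in> q_expansions q x \<and> remainder q (fst s) x (snd s) \<in> interior_points q"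
    for s :: "(nat \<Rightarrow> real) \<times> nat"
  define R where "R n s t \<longleftrightarrow> snd s < snd t \<and> (\<forall>i<snd s. fst t i = fst s i) \<and> (\<exists>j<snd t. fst t j \<noteq> e n j)"
    for n and s t :: "(nat \<Rightarrow> real) \<times> nat"
  have "\<exists>s. \<forall>n. P (s n) \<and> R n (s n) (s (Suc n))"
  proof (rule dependent_nat_choice)
    obtain d where "d \<in> q_expansions q x" using \<open>q_expansions q x \<noteq> {}\<close> by blast
    then show "\<exists>s. P s" using x by (intro exI[of _ "(d, 0)"]) (simp add: P_def)
  next
    fix s n assume "P s"
    obtain d l where s: "s = (d, l)" by (cases s)
    have d: "d \<in> q_expansions q x" "remainder q d x l \<in> interior_points q"
      using \<open>P s\<close> by (simp_all add: P_def s)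
    obtain a b m j where ab: "a \<in> q_expansions q (remainder q d x l)" "b \<in> q_expansions q (remainder q d x l)"
        "j < m" "a j \<noteq> b j" "remainder q a (remainder q d x l) m \<in> interior_points q"
        "remainder q b (remainder q d x l) m \<in> interior_points q"
      using interior_branching[OF d(2)] unfolding branching_def by blast
    \<comment> \<open>\<open>a\<close> and \<open>b\<close> differ at j, so at least one of them
      disagrees with \<open>e n\<close> at position l + j.\<close>
    define c where "c = (if a j \<noteq> e n (l + j) then a else b)"
    have c: "c \<in> q_expansions q (remainder q d x l)" "c j \<noteq> e n (l + j)"
        "remainder q c (remainder q d x l) m \<in> interior_points q"
      using ab by (auto simp: c_def)
    let ?f = "\<lambda>i. if i < l then d i else c (i - l)"
    have "P (?f, l + m)"
      using splice_expansion[OF q d(1) c(1)] c(3) by (simp add: P_def)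
    moreover have "R n s (?f, l + m)"
      using ab(3) c(2) by (auto simp: R_def s intro!: exI[of _ "l + j"])
    ultimately show "\<exists>t. P t \<and> R n s t" by blast
  qed
  then obtain s where P: "\<And>n. P (s n)" and R: "\<And>n. R n (s n) (s (Suc n))" by blast
  have mono: "strict_mono (\<lambda>n. snd (s n))"
    using R by (simp add: strict_mono_Suc_iff R_def)
  then have len: "n \<le> snd (s n)" for n by (rule strict_mono_imp_increasing)
  have agree: "fst (s (n + k)) i = fst (s n) i" if "i < snd (s n)" for n k i
  proof (induction k)
    case (Suc k)
    have "snd (s n) \<le> snd (s (n + k))" using strict_mono_mono[OF mono] by (simp add: mono_def)
    then show ?case using Suc R[of "n + k"] that by (simp add: R_def)
  qed simp
  \<comment> \<open>The prefix fixed at stage \<open>Suc i\<close> has length at least i + 1, so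
    digit i no longer changes.\<close>
  define D where "D i = fst (s (Suc i)) i" for i
  have D: "D i = fst (s n) i" if "i < snd (s n)" for n i
    using agree[OF that, of "Suc i"] agree[of i "Suc i" n] len[of "Suc i"] by (simp add: D_def add.commute)
  have "D i \<in> {0, 1, q}" for i
    using P unfolding P_def expansion_iff_remainder[OF q] D_def by blast
  moreover have "remainder q D x n \<in> {0..q / (q - 1)}" for n
  proof -
    have "remainder q D x n = remainder q (fst (s n)) x n"
      using D len[of n] by (intro remainder_cong) auto
    then show ?thesis using P[of n] unfolding P_def expansion_iff_remainder[OF q] by auto
  qed
  ultimately have "D \<in> q_expansions q x"
    unfolding expansion_iff_remainder[OF q] by blast
  then obtain n where "D = e n" using e by blast
  then show False using R[of n] D[of _ "Suc n"] by (auto simp: R_def)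
qed

end

section \<open>The three sets of bases\<close>

lemma bases_with_cardI:
  assumes "1 < q" "q_expansions q x \<approx> K" "K \<noteq> {}"
  shows "q \<in> bases_with_card K"
proof -
  have "q_expansions q x \<noteq> {}" using assms(2,3) by (auto simp: eqpoll_def bij_betw_def)
  then show ?thesis using assms by (auto simp: bases_with_card_def expandable_def)
qed

theorem theorem1:
  shows "bases_with_card (Pow (UNIV :: nat set)) = {1<..} \<and>
         bases_with_card (UNIV :: nat set) = {2..} \<and>
         (\<forall>k::nat. k \<ge> 2 \<longrightarrow> bases_with_card {..<k} = {q_c<..})"
proof (intro conjI allI impI set_eqI iffI)
  fix q :: real
  show "q \<in> {1<..}" if "q \<in> bases_with_card (Pow (UNIV :: nat set))"
    using that by (simp add: bases_with_card_def)
  show "q \<in> bases_with_card (Pow (UNIV :: nat set))" if "q \<in> {1<..}"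
    using that by (intro bases_with_cardI[OF _ continuum_expansions]) auto
  show "q \<in> bases_with_card (UNIV :: nat set)" if "q \<in> {2..}"
    using that by (intro bases_with_cardI[OF _ countable_infinite_expansions]) auto
  show "q \<in> {2..}" if q_in: "q \<in> bases_with_card (UNIV :: nat set)"
  proof (rule ccontr)
    assume "q \<notin> {2..}"
    obtain x where q: "1 < q" and x: "q_expansions q x \<approx> (UNIV :: nat set)"
      using q_in by (auto simp: bases_with_card_def)
    have q2: "q < 2" "q \<le> q_c" using \<open>q \<notin> {2..}\<close> q_c_approx by auto
    have inf: "infinite (q_expansions q x)" and count: "countable (q_expansions q x)"
      using x eqpoll_finite_iff[OF x] countable_eqpoll[OF _ x] by auto
    have "q_expansions q x \<noteq> {}" using inf by auto
    then have "x \<in> {0..q / (q - 1)}" using no_expansions[OF q] by blast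
    moreover have "x \<noteq> 0" "x \<noteq> q / (q - 1)"
      using inf expansion_unique_0[OF q] expansion_unique_top[OF q] by (auto simp: is_singleton_def)
    ultimately have "x \<in> interior_points q"
      using critical_facts(2)[OF q q2(2)] by (auto simp: interior_points_def)
    then show False using uncountable_expansions[OF q q2(1)] count by blast
  qed
  fix k :: nat
  assume k: "2 \<le> k"
  show "q \<in> bases_with_card {..<k}" if "q \<in> {q_c<..}"
  proof -
    have "q_c < q" using that by simp
    note gt = product_gt_1[OF this]
    obtain x where x: "finite (q_expansions q x)" "card (q_expansions q x) = Suc (k - 1)"
      using finitely_many_expansions[OF _ gt, of "k - 1"] gt by auto
    then have "q_expansions q x \<approx> {..<k}"
      using k by (subst eqpoll_iff_card) auto
    then show ?thesis using gt k by (intro bases_with_cardI) (auto simp: lessThan_empty_iff)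
  qed
  show "q \<in> {q_c<..}" if q_in: "q \<in> bases_with_card {..<k}"
  proof (rule ccontr)
    assume "q \<notin> {q_c<..}"
    obtain x where q: "1 < q" and x: "q_expansions q x \<approx> {..<k}"
      using q_in by (auto simp: bases_with_card_def)
    have "finite (q_expansions q x)" using eqpoll_finite_iff[OF x] by simp
    moreover from this have "card (q_expansions q x) = k"
      using x eqpoll_iff_card[of "q_expansions q x" "{..<k}"] by simp
    ultimately show False
      using finite_expansions_card_le_1[OF q] \<open>q \<notin> {q_c<..}\<close> k by fastforce
  qed
qed

end
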